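(* Let $k\in\mathbb Z$ and let $\{Q_i\}_{i\in\mathbb Z_+}$ be a sequence of symmetric quivers that grows by $(k,2k+2)$-splitting or by $(k,2k)$-splitting of $n$ nodes, and let $m_1$ be the number of nodes of $Q_1$. Then there exists an infinite quiver $Q_\infty$ (a symmetric integer matrix indexed by $\mathbb Z_+\times\mathbb Z_+$) such that for every $i\ge1$ the adjacency matrix of $Q_i$ (with nodes suitably ordered) is the top-left submatrix of that of $Q_\infty$ of size $(m_1+n(i-1))\times(m_1+n(i-1))$.
   Context: A symmetric quiver $Q=(C,\boldsymbol{x})$ is given by a symmetric integer matrix $C$ (negative entries allowed), its adjacency matrix, whose rows are indexed by the nodes, together with a vector $\boldsymbol{x}$ assigning to each node $i$ a generating parameter $x_i$. $(k,l)$-splitting. Data: a quiver $(C,\boldsymbol x)$, $n$ ordered chosen nodes $v_1,\dots,v_n$, a permutation $\sigma\in S_n$, an integer shift $h_s$ for every remaining node $s$ (called a spectator), and a multiplicative factor $\kappa$. The result has the old nodes, with all mutual entries of $C$ and all parameters unchanged, and $n$ new nodes $v_1',\dots,v_n'$ with parameters $x_{v_a'}=\kappa x_{v_a}$ and symmetric entries $C_{s v_a'}=C_{sv_a}+h_s$; $C_{v_av_a'}=C_{v_av_a}+k$; $C_{v_a'v_b'}=C_{v_av_b}+l$ (including $a=b$); and for $a<b$: if $\sigma(a)<\sigma(b)$ then $C_{v_av_b'}=C_{v_av_b}+k$, $C_{v_a'v_b}=C_{v_av_b}+k+1$; if $\sigma(a)>\sigma(b)$ then $C_{v_av_b'}=C_{v_av_b}+k+1$,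 $C_{v_a'v_b}=C_{v_av_b}+k$. Growth by $(k,l)$-splitting: $Q_2$ is obtained from $Q_1$ by $(k,l)$-splitting of $n\geq 1$ chosen nodes; for $i\ge2$, $Q_{i+1}$ is obtained from $Q_i$ by $(k,l)$-splitting of the $n$ nodes created in the previous step, all other nodes being spectators. *)

theory Defs
  imports Main "HOL-Combinatorics.Permutations"
begin

text \<open>Only the values of \<open>adj\<close> and \<open>par\<close> on \<open>nodes\<close> are meaningful.\<close>

record ('v, 'x) quiver =
  nodes :: "'v set"
  adj :: "'v \<Rightarrow> 'v \<Rightarrow> int"
  par :: "'v \<Rightarrow> 'x"

definition symmetric_quiver :: "('v, 'x) quiver \<Rightarrow> bool" where
  "symmetric_quiver Q \<longleftrightarrow>
     finite (nodes Q) \<and> (\<forall>s\<in>nodes Q. \<forall>t\<in>nodes Q. adj Q s t = adj Q t s)"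

text \<open>
  \<open>is_splitting k l n v \<sigma> h \<kappa> v' Q Q'\<close>: the quiver \<open>Q'\<close> is the result of the
  \<open>(k,l)\<close>-splitting of the nodes \<open>v 1, \<dots>, v n\<close> of \<open>Q\<close> with permutation \<open>\<sigma>\<close>, shifts \<open>h\<close>
  and multiplicative factor \<open>\<kappa>\<close>, where \<open>v' a\<close> is the new node split off from \<open>v a\<close>.
  This is a relation because the names of the new nodes are arbitrary.  Each entry is
  prescribed in one orientation only; the other one follows from the symmetry of \<open>Q'\<close>.
\<close>

definition is_splitting ::
  "int \<Rightarrow> int \<Rightarrow> nat \<Rightarrow> (nat \<Rightarrow> 'v) \<Rightarrow> (nat \<Rightarrow> nat) \<Rightarrow> ('v \<Rightarrow> int) \<Rightarrow> 'x::comm_monoid_mult \<Rightarrow>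
   (nat \<Rightarrow> 'v) \<Rightarrow> ('v, 'x) quiver \<Rightarrow> ('v, 'x) quiver \<Rightarrow> bool" where
  "is_splitting k l n v \<sigma> h \<kappa> v' Q Q' \<longleftrightarrow>
     symmetric_quiver Q \<and> symmetric_quiver Q' \<and>
     inj_on v {1..n} \<and> v ` {1..n} \<subseteq> nodes Q \<and> \<sigma> permutes {1..n} \<and>
     inj_on v' {1..n} \<and> v' ` {1..n} \<inter> nodes Q = {} \<and>
     nodes Q' = nodes Q \<union> v' ` {1..n} \<and>
     (\<forall>s\<in>nodes Q. \<forall>t\<in>nodes Q. adj Q' s t = adj Q s t) \<and>
     (\<forall>s\<in>nodes Q. par Q' s = par Q s) \<and>
     (\<forall>a\<in>{1..n}. par Q' (v' a) = \<kappa> * par Q (v a)) \<and>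
     (\<forall>s\<in>nodes Q - v ` {1..n}. \<forall>a\<in>{1..n}. adj Q' s (v' a) = adj Q s (v a) + h s) \<and>
     (\<forall>a\<in>{1..n}. adj Q' (v a) (v' a) = adj Q (v a) (v a) + k) \<and>
     (\<forall>a\<in>{1..n}. \<forall>b\<in>{1..n}. adj Q' (v' a) (v' b) = adj Q (v a) (v b) + l) \<and>
     (\<forall>a\<in>{1..n}. \<forall>b\<in>{1..n}. a < b \<longrightarrow>
        (if \<sigma> a < \<sigma> b
         then adj Q' (v a) (v' b) = adj Q (v a) (v b) + k \<and>
              adj Q' (v' a) (v b) = adj Q (v a) (v b) + k + 1
         else adj Q' (v a) (v' b) = adj Q (v a) (v b) + k + 1 \<and>
              adj Q' (v' a) (v b) = adj Q (v a) (v b) + k))"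

text \<open>
  The sequence is indexed by \<open>i \<ge> 1\<close> (the value \<open>Q 0\<close> is irrelevant).  In step \<open>i\<close> the nodes
  \<open>v i 1, \<dots>, v i n\<close> are split and \<open>w i 1, \<dots>, w i n\<close> are created; the created nodes may be
  reordered before the next step, and every step has its own permutation, shifts and factor.
\<close>

definition grows_by_splitting ::
  "int \<Rightarrow> int \<Rightarrow> nat \<Rightarrow> (nat \<Rightarrow> ('v, 'x::comm_monoid_mult) quiver) \<Rightarrow> bool" where
  "grows_by_splitting k l n Q \<longleftrightarrow>
     n \<ge> 1 \<and>
     (\<exists>v w. (\<forall>i\<ge>1. \<exists>\<sigma> h \<kappa>. is_splitting k l n (v i) \<sigma> h \<kappa> (w i) (Q i) (Q (i + 1))) \<and>
            (\<forall>i\<ge>1. v (i + 1) ` {1..n} = w i ` {1..n}))"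

end

theory Submission
  imports Defs
begin

text \<open>
  Splitting never changes the entries between old nodes, so the adjacency matrices of the
  quivers extend one another as soon as the nodes are ordered by the step that creates them.
  The infinite matrix is their union; the particular values of the new entries play no role.
\<close>

text \<open>A single \<open>e\<close> serves all stages at once: an enumeration of
  \<open>A 0\<close> comes first, followed by one block of length \<open>n\<close> per step. Each
  new block is disjoint from what precedes it, so bijectivity passes from one stage to the
  next.\<close>

lemma ex_enumeration_of_blockwise_chain:
  fixes A :: "nat \<Rightarrow> 'a set"
  assumes fin: "finite (A 0)"
    and step: "\<And>i. A (Suc i) = A i \<union> w i ` {1..n}"
    and inj: "\<And>i. inj_on (w i) {1..n}"
    and disj: "\<And>i. w i ` {1..n} \<inter> A i = {}"
  shows "\<exists>e. \<forall>i. bij_betw e {1..card (A 0) + n * i} (A i)"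
proof -
  let ?m = "card (A 0)"
  obtain f where f: "bij_betw f {1..?m} (A 0)"
    using ex_bij_betw_nat_finite_1[OF fin] by blast
  \<comment> \<open>Past \<open>?m\<close>, the quotient by \<open>n\<close> selects the step and
    the remainder the place within its block. Positions and the arguments of \<open>w i\<close> both
    count from 1, hence the \<open>- 1\<close> before dividing and the \<open>+ 1\<close>
    after.\<close>
  define e where "e r = (if r \<le> ?m then f r
    else w ((r - ?m - 1) div n) ((r - ?m - 1) mod n + 1))" for r
  have block: "e (?m + n * i + j) = w i j" if "j \<in> {1..n}" for i j
  proof -
    \<comment> \<open>With \<open>j' < n\<close>, dividing \<open>n * i + j'\<close> by
      \<open>n\<close> gives quotient \<open>i\<close> and remainder \<open>j'\<close>; even
      \<open>j = n\<close> stays in block \<open>i\<close>.\<close>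
    obtain j' where "j = Suc j'" "j' < n"
      using \<open>j \<in> {1..n}\<close> by (intro that[of "j - 1"]) auto
    then show ?thesis by (simp add: e_def)
  qed
  have "bij_betw e {1..?m + n * i} (A i)" for i
  proof (induction i)
    case 0
    have "bij_betw e {1..?m} (A 0) \<longleftrightarrow> bij_betw f {1..?m} (A 0)"
      by (rule bij_betw_cong) (simp add: e_def)
    with f show ?case by simp
  next
    case (Suc i)
    let ?B = "(+) (?m + n * i) ` {1..n}"
    \<comment> \<open>After translation to \<open>{1..n}\<close>, \<open>e\<close> on the new block
      is just \<open>w i\<close>, whose injectivity is given.\<close>
    have "bij_betw (e \<circ> (+) (?m + n * i)) {1..n} (w i ` {1..n}) \<longleftrightarrow>
          bij_betw (w i) {1..n} (w i ` {1..n})"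
      by (rule bij_betw_cong) (simp add: block)
    moreover have "bij_betw ((+) (?m + n * i)) {1..n} ?B"
      by (simp add: bij_betw_def)
    ultimately have "bij_betw e ?B (w i ` {1..n})"
      using bij_betw_comp_iff inj_on_imp_bij_betw[OF inj[of i]] by blast
    moreover have "{1..?m + n * Suc i} = {1..?m + n * i} \<union> ?B"
      by auto
    ultimately show ?case
      using bij_betw_combine[OF Suc.IH] disj[of i] by (simp add: step Int_commute)
  qed
  then show ?thesis by blast
qed

text \<open>The one-step equation iterates because the growing node sets keep \<open>s\<close> and
  \<open>t\<close> among the old nodes at every later step.\<close>

lemma adj_stable:
  assumes "\<And>i. nodes (Q i) \<subseteq> nodes (Q (Suc i))"
    and "\<And>i s t. s \<in> nodes (Q i) \<Longrightarrow> t \<in> nodes (Q i) \<Longrightarrow> adj (Q (Suc i)) s t = adj (Q i) s t"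
    and "i \<le> j" "s \<in> nodes (Q i)" "t \<in> nodes (Q i)"
  shows "adj (Q j) s t = adj (Q i) s t"
  using \<open>i \<le> j\<close>
proof (induction j rule: dec_induct)
  case (step j)
  have "nodes (Q i) \<subseteq> nodes (Q j)"
    using assms(1) step.hyps(1) by (rule lift_Suc_mono_le)
  then have "adj (Q (Suc j)) s t = adj (Q j) s t"
    using assms(4,5) by (intro assms(2)) auto
  with step.IH show ?case by simp
qed simp

theorem proposition3p9:
  fixes k :: int and n m1 :: nat
    and Q :: "nat \<Rightarrow> ('v, 'x::comm_monoid_mult) quiver"
  assumes "grows_by_splitting k (2 * k + 2) n Q \<or> grows_by_splitting k (2 * k) n Q"
    and "m1 = card (nodes (Q 1))"
  shows "\<exists>Q_inf :: nat \<Rightarrow> nat \<Rightarrow> int.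
           (\<forall>r\<ge>1. \<forall>s\<ge>1. Q_inf r s = Q_inf s r) \<and>
           (\<forall>i\<ge>1. \<exists>u. bij_betw u {1..m1 + n * (i - 1)} (nodes (Q i)) \<and>
              (\<forall>r\<in>{1..m1 + n * (i - 1)}. \<forall>s\<in>{1..m1 + n * (i - 1)}.
                 adj (Q i) (u r) (u s) = Q_inf r s))"
proof -
  obtain l where "grows_by_splitting k l n Q"
    using assms(1) by blast
  then obtain v w where n: "n \<ge> 1" and
    step: "\<forall>i\<ge>1. \<exists>\<sigma> h \<kappa>. is_splitting k l n (v i) \<sigma> h \<kappa> (w i) (Q i) (Q (i + 1))"
    unfolding grows_by_splitting_def by (elim conjE exE)
  \<comment> \<open>Reindexing from 0 matches the form of the two lemmas above.\<close>
  define P where "P i = Q (Suc i)" for i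
  have split: "\<exists>\<sigma> h \<kappa>. is_splitting k l n (v (Suc i)) \<sigma> h \<kappa> (w (Suc i)) (P i) (P (Suc i))" for i
    using step[rule_format, of "Suc i"] by (simp add: P_def)
  have sym: "symmetric_quiver (P i)"
    and inj: "inj_on (w (Suc i)) {1..n}"
    and disj: "w (Suc i) ` {1..n} \<inter> nodes (P i) = {}"
    and nodes_Suc: "nodes (P (Suc i)) = nodes (P i) \<union> w (Suc i) ` {1..n}"
    and adj_Suc': "\<forall>s\<in>nodes (P i). \<forall>t\<in>nodes (P i). adj (P (Suc i)) s t = adj (P i) s t" for i
    using split[of i] unfolding is_splitting_def by - (elim exE conjE, assumption)+
  have adj_Suc: "adj (P (Suc i)) s t = adj (P i) s t"
    if "s \<in> nodes (P i)" "t \<in> nodes (P i)" for i s t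
    using adj_Suc' that by blast
  have stable: "adj (P j) s t = adj (P i) s t"
    if "i \<le> j" "s \<in> nodes (P i)" "t \<in> nodes (P i)" for i j s t
    using adj_stable[of P, OF _ adj_Suc that] nodes_Suc by blast
  have "finite (nodes (P 0))"
    using sym by (simp add: symmetric_quiver_def)
  then obtain e where "\<And>i. bij_betw e {1..card (nodes (P 0)) + n * i} (nodes (P i))"
    using ex_enumeration_of_blockwise_chain[of "\<lambda>i. nodes (P i)" "\<lambda>i. w (Suc i)" n,
        OF _ nodes_Suc inj disj] by auto
  then have e: "bij_betw e {1..m1 + n * i} (nodes (P i))" for i
    by (simp add: assms(2) P_def)
  have e_mem: "e r \<in> nodes (P i)" if "r \<in> {1..m1 + n * i}" for r i
    using bij_betwE[OF e] that by blast
  \<comment> \<open>Since \<open>n \<ge> 1\<close>, every step adds a node, so the node in position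
    \<open>r\<close> has appeared by stage \<open>r\<close>.\<close>
  have e_mem_self: "e r \<in> nodes (P j)" if "1 \<le> r" "r \<le> j" for r j
  proof (rule e_mem)
    have "j \<le> n * j" using n by (cases n) simp_all
    with that have "r \<le> m1 + n * j" by linarith
    with that show "r \<in> {1..m1 + n * j}" by simp
  qed
  \<comment> \<open>For positive \<open>r\<close> and \<open>s\<close>, both nodes exist at stage
    \<open>max r s\<close>; by stability, any other stage containing both gives the same
    entry.\<close>
  define Q_inf where "Q_inf r s = adj (P (max r s)) (e r) (e s)" for r s
  have "Q_inf r s = Q_inf s r" if "r \<ge> 1" "s \<ge> 1" for r s
    using sym[of "max r s"] e_mem_self that
    by (simp add: Q_inf_def symmetric_quiver_def max.commute)
  moreover have "bij_betw e {1..m1 + n * (i - 1)} (nodes (Q i)) \<and>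
      (\<forall>r\<in>{1..m1 + n * (i - 1)}. \<forall>s\<in>{1..m1 + n * (i - 1)}.
         adj (Q i) (e r) (e s) = Q_inf r s)" if "i \<ge> 1" for i
  proof (intro conjI ballI)
    have P: "P (i - 1) = Q i"
      using that by (simp add: P_def)
    show "bij_betw e {1..m1 + n * (i - 1)} (nodes (Q i))"
      using e[of "i - 1"] by (simp only: P)
    fix r s
    assume r: "r \<in> {1..m1 + n * (i - 1)}" and s: "s \<in> {1..m1 + n * (i - 1)}"
    have "e r \<in> nodes (P (max r s))" "e s \<in> nodes (P (max r s))"
      using r s by (auto intro!: e_mem_self)
    \<comment> \<open>Either of the stages \<open>i - 1\<close> and \<open>max r s\<close> may be
      the earlier one. Both nodes are present at each, so stability applies in both cases.\<close>
    then have "adj (P (i - 1)) (e r) (e s) = Q_inf r s"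
      unfolding Q_inf_def
      using stable[OF _ e_mem[OF r] e_mem[OF s]] stable[of "max r s" "i - 1"] by (metis linear)
    then show "adj (Q i) (e r) (e s) = Q_inf r s"
      by (simp only: P)
  qed
  ultimately show ?thesis
    by (intro exI[of _ Q_inf] conjI allI impI exI[of _ e]) simp_all
qed

end
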